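(* Let $n\ge1$ and $c\in\mathrm{Rec}_n$, and let $\mathrm{minrec}(c)$ be the output of the reduction algorithm on $c$ (a minimal recurrent configuration). Let $p(c)=(n-c_1,\dots,n-c_n)$. Then $\mathcal{O}_{\mathrm{MVP}_n}(p(c))=\mathrm{CanTop}(\mathrm{minrec}(c))$.
   Context: Abelian sandpile model on $K_n$: a configuration is $c\in\mathbb{Z}_{\ge0}^n$; vertex $i$ is stable if $c_i<n$. Toppling an unstable vertex $i$ subtracts $n$ from $c_i$ and adds $1$ to every other $c_j$. Fix a distribution $\mu$ on $[n]$ with all $\mu_i>0$; the Markov chain on stable configurations adds a grain at $i$ with probability $\mu_i$ and stabilises. $\mathrm{Rec}_n$ is its set of recurrent configurations (equivalently, stable $c$ such that $(n-c_1,\dots,n-c_n)$ is a parking function). Minimal recurrent configurations (componentwise-minimal elements of $\mathrm{Rec}_n$) are exactly the permutations of $\{0,\dots,n-1\}$. For such $c$, $\mathrm{CanTop}(c)$ is the permutation $\pi\in S_n$ with $\pi_i$ the unique index $j$ with $c_j=n-i$. Reduction algorithm on input $c$: repeat: (1) if the entries of $c$ are pairwise distinct, return $c$; otherwise let $j=\min\{j': c_{j'}\in\{c_1,\dots,c_{j'-1}\}\}$ and $i<j$ the index with $c_i=c_j$; (2) while some $j'\in\{1,\dots,j\}\setminus\{i\}$ has $c_{j'}=c_i$, decrease $c_i$ by one. MVP parking process for $p\in[n]^n$: cars $1,\dots,n$ enter in order a one-way street with spots $1,\dots,n$; car $i$ parks in spot $p_i$, and if $p_i$ was occupied by an earlier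 car $j$, car $j$ is bumped and parks in the first unoccupied spot $k>p_i$ (bumped cars do not bump others). The outcome $\mathcal{O}_{\mathrm{MVP}_n}(p)$ is the permutation $\pi$ with $\pi_i$ the car in spot $i$ at the end. *)

theory Defs
  imports
    "HOL-Probability.Probability"
    "HOL-Combinatorics.Permutations"
    "HOL-Library.Confluence"
begin

text \<open>
  A configuration $(c_1, \ldots, c_n)$ is a function on \<open>{1..n}\<close>, extended by \<open>undefined\<close>
  outside (\<^const>\<open>PiE\<close>), so that equality of functions is equality of tuples.
\<close>

type_synonym config = "nat \<Rightarrow> nat"

definition configs :: "nat \<Rightarrow> config set" where
  "configs n = {1..n} \<rightarrow>\<^sub>E UNIV"

definition stable_configs :: "nat \<Rightarrow> config set" where
  "stable_configs n = {c \<in> configs n. \<forall>i\<in>{1..n}. c i < n}"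

text \<open>
  A toppling vertex loses \<open>n\<close> grains, but there are only \<open>n - 1\<close> other vertices: one grain
  leaves the system.
\<close>

definition topple :: "nat \<Rightarrow> nat \<Rightarrow> config \<Rightarrow> config" where
  "topple n i c = (\<lambda>j\<in>{1..n}. if j = i then c j - n else c j + 1)"

definition topples_to :: "nat \<Rightarrow> config \<Rightarrow> config \<Rightarrow> bool" where
  "topples_to n c d \<longleftrightarrow> (\<exists>i\<in>{1..n}. n \<le> c i \<and> d = topple n i c)"

definition stabilise :: "nat \<Rightarrow> config \<Rightarrow> config" where
  "stabilise n c = (THE d. (topples_to n)\<^sup>*\<^sup>* c d \<and> d \<in> stable_configs n)"

lemma topple_in_configs: "topple n i c \<in> configs n"
  by (auto simp: topple_def configs_def)

lemma sum_topple:
  assumes "i \<in> {1..n}" "n \<le> c i"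
  shows "Suc (sum (topple n i c) {1..n}) = sum c {1..n}"
proof -
  have "sum (topple n i c) {1..n} = (c i - n) + (\<Sum>j\<in>{1..n} - {i}. c j + 1)"
    using assms(1) by (subst sum.remove[of _ i]) (auto simp: topple_def intro!: sum.cong)
  also have "\<dots> = (c i - n) + sum c ({1..n} - {i}) + (n - 1)"
    using assms(1) by (simp add: sum_Suc)
  finally show ?thesis
    using assms by (subst sum.remove[of _ i c]) auto
qed

lemma topple_commute:
  assumes "i \<noteq> j" "n \<le> c i" "n \<le> c j"
  shows "topple n i (topple n j c) = topple n j (topple n i c)"
  using assms by (auto simp: topple_def fun_eq_iff)

lemma confluentp_topples_to: "confluentp (topples_to n)"
proof (rule strong_confluentp_imp_confluentp, rule strong_confluentpI)
  fix c d e assume "topples_to n c d" "topples_to n c e"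
  then obtain i j where i: "i \<in> {1..n}" "n \<le> c i" "d = topple n i c"
    and j: "j \<in> {1..n}" "n \<le> c j" "e = topple n j c"
    by (auto simp: topples_to_def)
  show "\<exists>u. (topples_to n)\<^sup>*\<^sup>* d u \<and> (topples_to n)\<^sup>=\<^sup>= e u"
  proof (cases "i = j")
    case True
    then show ?thesis using i j by auto
  next
    case False
    have "topples_to n d (topple n j d)" "topples_to n e (topple n i e)"
      using i j False by (auto simp: topples_to_def topple_def)
    moreover have "topple n j d = topple n i e"
      using topple_commute[OF False i(2) j(2)] i j by simp
    ultimately show ?thesis by (metis r_into_rtranclp sup2CI)
  qed
qed

lemma ex1_stabilisation:
  assumes "c \<in> configs n"
  shows "\<exists>!d. (topples_to n)\<^sup>*\<^sup>* c d \<and> d \<in> stable_configs n"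
proof (rule ex_ex1I)
  show "\<exists>d. (topples_to n)\<^sup>*\<^sup>* c d \<and> d \<in> stable_configs n"
    using assms
  proof (induction "sum c {1..n}" arbitrary: c rule: less_induct)
    case less
    show ?case
    proof (cases "c \<in> stable_configs n")
      case False
      then obtain i where i: "i \<in> {1..n}" "n \<le> c i"
        using less.prems by (auto simp: stable_configs_def not_less)
      then have "sum (topple n i c) {1..n} < sum c {1..n}"
        using sum_topple[of i n c] by simp
      from less.hyps[OF this topple_in_configs]
      obtain d where "(topples_to n)\<^sup>*\<^sup>* (topple n i c) d" "d \<in> stable_configs n"
        by blast
      moreover have "topples_to n c (topple n i c)"
        using i by (auto simp: topples_to_def)
      ultimately show ?thesis by (meson converse_rtranclp_into_rtranclp)
    qed blast
  qed
next
  fix d e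
  assume d: "(topples_to n)\<^sup>*\<^sup>* c d \<and> d \<in> stable_configs n"
    and e: "(topples_to n)\<^sup>*\<^sup>* c e \<and> e \<in> stable_configs n"
  have final: "y = x" if "(topples_to n)\<^sup>*\<^sup>* x y" "x \<in> stable_configs n" for x y
    using that
    by (cases rule: converse_rtranclpE) (auto simp: topples_to_def stable_configs_def)
  obtain u where "(topples_to n)\<^sup>*\<^sup>* d u" "(topples_to n)\<^sup>*\<^sup>* e u"
    using confluentpD[OF confluentp_topples_to] d e by meson
  then show "d = e" using final d e by metis
qed

definition sandpile_kernel :: "nat \<Rightarrow> nat pmf \<Rightarrow> config \<Rightarrow> config pmf" where
  "sandpile_kernel n \<mu> c = map_pmf (\<lambda>i. stabilise n (c(i := c i + 1))) \<mu>"

text \<open>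
  \<open>walk K k x\<close> is the joint law of $(X_1, \ldots, X_k)$ for the Markov chain with kernel \<open>K\<close>
  started at $X_0 = x$.
\<close>

primrec walk :: "('s \<Rightarrow> 's pmf) \<Rightarrow> nat \<Rightarrow> 's \<Rightarrow> 's list pmf" where
  "walk K 0 x = return_pmf []"
| "walk K (Suc k) x = bind_pmf (K x) (\<lambda>y. map_pmf ((#) y) (walk K k y))"

text \<open>
  The return time $T = \min \{t \ge 1. X_t = x\}$ is almost surely finite iff
  $P_x(T \le k)$ tends to $1$.
\<close>

definition recurrent_state :: "('s \<Rightarrow> 's pmf) \<Rightarrow> 's \<Rightarrow> bool" where
  "recurrent_state K x \<longleftrightarrow>
     (\<lambda>k. measure_pmf.prob (walk K k x) {xs. x \<in> set xs}) \<longlonglongrightarrow> 1"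

definition Rec :: "nat \<Rightarrow> nat pmf \<Rightarrow> config set" where
  "Rec n \<mu> = {c \<in> stable_configs n. recurrent_state (sandpile_kernel n \<mu>) c}"

definition MinRec :: "nat \<Rightarrow> nat pmf \<Rightarrow> config set" where
  "MinRec n \<mu> = {c \<in> Rec n \<mu>. \<forall>d\<in>Rec n \<mu>. (\<forall>i\<in>{1..n}. d i \<le> c i) \<longrightarrow> d = c}"

text \<open>
  Permutations of \<open>{1..n}\<close> are the identity outside \<open>{1..n}\<close>, as for \<^const>\<open>permutes\<close>.
\<close>

definition CanTop :: "nat \<Rightarrow> config \<Rightarrow> nat \<Rightarrow> nat" where
  "CanTop n c = restrict_id (\<lambda>i. THE j. j \<in> {1..n} \<and> c j = n - i) {1..n}"

text \<open>
  The two loops of the reduction algorithm; the result \<^const>\<open>None\<close> means non-termination.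
  In particular \<open>lower_entry\<close> diverges, rather than producing a negative entry, if the entry
  \<open>c i\<close> reaches \<open>0\<close> while a coincidence remains.
\<close>

partial_function (option) lower_entry :: "nat \<Rightarrow> nat \<Rightarrow> config \<Rightarrow> config option" where
  "lower_entry i j c =
     (if \<exists>j'\<in>{1..j} - {i}. c j' = c i then lower_entry i j (c(i := c i - 1)) else Some c)"

definition first_repeat :: "config \<Rightarrow> nat" where
  "first_repeat c = (LEAST j. 1 \<le> j \<and> c j \<in> c ` {1..<j})"

partial_function (option) reduction :: "nat \<Rightarrow> config \<Rightarrow> config option" where
  "reduction n c =
     (if inj_on c {1..n} then Some c
      else let j = first_repeat c;
               i = (THE i. i \<in> {1..<j} \<and> c i = c j)
           in Option.bind (lower_entry i j c) (reduction n))"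

definition parking_preference :: "nat \<Rightarrow> config \<Rightarrow> nat \<Rightarrow> nat" where
  "parking_preference n c = (\<lambda>i\<in>{1..n}. n - c i)"

text \<open>
  The street is a partial map from spots to cars. A bumped car that finds no unoccupied spot
  leaves the street; if this happens, some spot is empty at the end and there is no outcome.
\<close>

definition mvp_step :: "nat \<Rightarrow> (nat \<Rightarrow> nat) \<Rightarrow> (nat \<rightharpoonup> nat) \<Rightarrow> nat \<Rightarrow> (nat \<rightharpoonup> nat)" where
  "mvp_step n p s i =
     (case s (p i) of
        None \<Rightarrow> s(p i \<mapsto> i)
      | Some j \<Rightarrow>
          if \<exists>k\<in>{p i<..n}. s k = None
          then s(p i \<mapsto> i, (LEAST k. p i < k \<and> s k = None) \<mapsto> j)
          else s(p i \<mapsto> i))"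

definition mvp_outcome :: "nat \<Rightarrow> (nat \<Rightarrow> nat) \<Rightarrow> (nat \<Rightarrow> nat) option" where
  "mvp_outcome n p =
     (let s = foldl (mvp_step n p) Map.empty [1..<n+1]
      in if {1..n} \<subseteq> dom s then Some (restrict_id (\<lambda>k. the (s k)) {1..n}) else None)"

end

theory Submission
  imports Defs
begin

text \<open>
  A recurrent configuration is parking: parking configurations are closed under the chain, and any
  stable configuration leads, without topplings, to the full one, which is parking; so a
  configuration that is not parking is left forever with positive probability. Conversely, adding
  one grain to every vertex of a permutation of \<open>0, \<dots>, n - 1\<close> makes every vertex topple exactly
  once and gives the permutation back. Hence every stable configuration leads to every permutation,
  which is therefore recurrent.

  The reduction algorithm and the MVP process run in lockstep: after the first \<open>j\<close> indices are made
  distinct, giving \<open>m\<close>, the first \<open>j\<close> cars occupy the spots \<open>n - m i\<close>. Lowering the entry of the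
  earlier index to the next missing value is bumping the earlier car to the next free spot.
\<close>

section \<open>Parking configurations and stabilisation\<close>

text \<open>With \<open>n - c i\<close> as the preferred spot of car \<open>i\<close>, this is the
  classical parking condition: at least \<open>k\<close> cars prefer a spot among the first
  \<open>k\<close>. It makes sense for unstable configurations too, so it can be followed through
  single topplings.\<close>

definition parking :: "nat \<Rightarrow> config \<Rightarrow> bool" where
  "parking n c \<longleftrightarrow> (\<forall>k\<in>{1..n}. k \<le> card {i \<in> {1..n}. n \<le> c i + k})"

lemma parking_mono:
  assumes "parking n c" "\<And>i. i \<in> {1..n} \<Longrightarrow> c i \<le> d i"
  shows "parking n d"
  unfolding parking_def
proof
  fix k assume k: "k \<in> {1..n}"
  have "k \<le> card {i \<in> {1..n}. n \<le> c i + k}"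
    using assms(1) k unfolding parking_def by blast
  also have "\<dots> \<le> card {i \<in> {1..n}. n \<le> d i + k}"
  proof (intro card_mono subsetI)
    fix i assume "i \<in> {i \<in> {1..n}. n \<le> c i + k}"
    then show "i \<in> {i \<in> {1..n}. n \<le> d i + k}" using assms(2)[of i] by simp
  qed simp
  finally show "k \<le> card {i \<in> {1..n}. n \<le> d i + k}" .
qed

text \<open>Every vertex other than \<open>i\<close> gains a grain, so the vertices counted for
  \<open>Suc k\<close> before the toppling, except possibly \<open>i\<close>, are counted for
  \<open>k\<close> after it.\<close>

lemma parking_topple:
  assumes "parking n c" "i \<in> {1..n}"
  shows "parking n (topple n i c)"
  unfolding parking_def
proof
  fix k assume k: "k \<in> {1..n}"
  show "k \<le> card {j \<in> {1..n}. n \<le> topple n i c j + k}"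
  proof (cases "k = n")
    case True
    then have "{j \<in> {1..n}. n \<le> topple n i c j + k} = {1..n}" by auto
    then show ?thesis using True by simp
  next
    case False
    then have "Suc k \<in> {1..n}" using k by auto
    then have "Suc k \<le> card {j \<in> {1..n}. n \<le> c j + Suc k}"
      using assms(1) unfolding parking_def by blast
    then have "k \<le> card {j \<in> {1..n}. n \<le> c j + Suc k} - 1" by linarith
    also have "\<dots> \<le> card ({j \<in> {1..n}. n \<le> c j + Suc k} - {i})"
      by (rule order_trans[OF _ diff_card_le_card_Diff]) auto
    also have "\<dots> \<le> card {j \<in> {1..n}. n \<le> topple n i c j + k}"
      by (intro card_mono) (auto simp: topple_def)
    finally show ?thesis .
  qed
qed

lemma parking_topples_to_rtranclp:
  assumes "(topples_to n)\<^sup>*\<^sup>* c d" "parking n c"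
  shows "parking n d"
  using assms by (induction) (auto simp: topples_to_def intro: parking_topple)

text \<open>The parking condition at \<open>k = n - v\<close>, passed to complements; the later
  counting arguments use this form.\<close>

lemma parking_card_below:
  assumes "parking n c" "v < n"
  shows "card {i \<in> {1..n}. c i < v} \<le> v"
proof (cases "v = 0")
  case False
  have "n - v \<in> {1..n}" using assms(2) False by auto
  then have "n - v \<le> card {i \<in> {1..n}. n \<le> c i + (n - v)}"
    using assms(1) unfolding parking_def by blast
  also have "{i \<in> {1..n}. n \<le> c i + (n - v)} = {1..n} - {i \<in> {1..n}. c i < v}"
    using assms(2) by auto
  also have "card \<dots> = n - card {i \<in> {1..n}. c i < v}"
    by (subst card_Diff_subset) auto
  finally show ?thesis using assms(2) by linarith
qed simp

section \<open>Stabilisation and one step of the chain\<close>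

lemma stabilise_props:
  assumes "c \<in> configs n"
  shows "(topples_to n)\<^sup>*\<^sup>* c (stabilise n c)" "stabilise n c \<in> stable_configs n"
  using theI'[OF ex1_stabilisation[OF assms]] unfolding stabilise_def by auto

lemma stabilise_eqI:
  assumes "c \<in> configs n" "(topples_to n)\<^sup>*\<^sup>* c d" "d \<in> stable_configs n"
  shows "stabilise n c = d"
  unfolding stabilise_def
  by (rule the1_equality[OF ex1_stabilisation[OF assms(1)]]) (use assms(2,3) in simp)

lemma stable_topples_to_rtranclp:
  assumes "(topples_to n)\<^sup>*\<^sup>* c d" "c \<in> stable_configs n"
  shows "d = c"
  using assms by (cases rule: converse_rtranclpE) (auto simp: topples_to_def stable_configs_def)

lemma stabilise_stable: "c \<in> stable_configs n \<Longrightarrow> stabilise n c = c"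
  by (rule stabilise_eqI) (auto simp: stable_configs_def)

lemma configs_upd: "c \<in> configs n \<Longrightarrow> i \<in> {1..n} \<Longrightarrow> c(i := v) \<in> configs n"
  by (auto simp: configs_def PiE_def extensional_def)

lemma stable_configsD: "c \<in> stable_configs n \<Longrightarrow> c \<in> configs n"
  by (simp add: stable_configs_def)

lemma finite_stable_configs: "finite (stable_configs n)"
proof (rule finite_subset)
  show "stable_configs n \<subseteq> {1..n} \<rightarrow>\<^sub>E {..<n}"
    by (auto simp: stable_configs_def configs_def PiE_def)
qed (auto intro: finite_PiE)

lemma set_sandpile_kernel:
  assumes "set_pmf \<mu> = {1..n}"
  shows "set_pmf (sandpile_kernel n \<mu> c) = (\<lambda>i. stabilise n (c(i := c i + 1))) ` {1..n}"
  using assms by (simp add: sandpile_kernel_def)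

lemma sandpile_kernel_stable:
  assumes "set_pmf \<mu> = {1..n}" "c \<in> stable_configs n" "d \<in> set_pmf (sandpile_kernel n \<mu> c)"
  shows "d \<in> stable_configs n"
proof -
  obtain i where "i \<in> {1..n}" "d = stabilise n (c(i := c i + 1))"
    using assms by (auto simp: set_sandpile_kernel)
  then show ?thesis using stabilise_props(2) configs_upd stable_configsD[OF assms(2)] by metis
qed

lemma sandpile_kernel_parking:
  assumes "set_pmf \<mu> = {1..n}" "c \<in> stable_configs n" "parking n c"
    and "d \<in> set_pmf (sandpile_kernel n \<mu> c)"
  shows "parking n d"
proof -
  obtain i where i: "i \<in> {1..n}" "d = stabilise n (c(i := c i + 1))"
    using assms by (auto simp: set_sandpile_kernel)
  have "parking n (c(i := c i + 1))"
    by (rule parking_mono[OF assms(3)]) auto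
  then show ?thesis
    using parking_topples_to_rtranclp stabilise_props(1) configs_upd stable_configsD assms(2) i by metis
qed

section \<open>Avoidance probabilities and recurrence\<close>

text \<open>\<open>walk\<close> does not record its starting state, so for \<open>y = x\<close> this
  is the probability that the return time to \<open>x\<close> exceeds \<open>k\<close>.\<close>

definition avoid_prob :: "('s \<Rightarrow> 's pmf) \<Rightarrow> 's \<Rightarrow> nat \<Rightarrow> 's \<Rightarrow> real" where
  "avoid_prob K x k y = measure_pmf.prob (walk K k y) {xs. x \<notin> set xs}"

lemma avoid_prob_0 [simp]: "avoid_prob K x 0 y = 1"
  by (simp add: avoid_prob_def)

lemma avoid_prob_nonneg: "0 \<le> avoid_prob K x k y"
  by (simp add: avoid_prob_def)

lemma avoid_prob_le_1: "avoid_prob K x k y \<le> 1"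
  by (simp add: avoid_prob_def)

text \<open>First-step analysis: condition on the first state \<open>z\<close>; if
  \<open>z = x\<close> avoidance has failed, otherwise the walk restarts from
  \<open>z\<close>.\<close>

lemma avoid_prob_Suc:
  "avoid_prob K x (Suc k) y =
    measure_pmf.expectation (K y) (\<lambda>z. if z = x then 0 else avoid_prob K x k z)"
proof -
  have "avoid_prob K x (Suc k) y = measure_pmf.expectation (K y)
      (\<lambda>z. measure_pmf.prob (map_pmf ((#) z) (walk K k z)) {xs. x \<notin> set xs})"
    unfolding avoid_prob_def walk.simps
    unfolding measure_pmf_bind
    by (rule measure_pmf.measure_bind[where N = "count_space UNIV"]) (auto simp: measure_subprob)
  also have "\<dots> = measure_pmf.expectation (K y) (\<lambda>z. if z = x then 0 else avoid_prob K x k z)"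
    by (intro Bochner_Integration.integral_cong) (auto simp: avoid_prob_def vimage_def)
  finally show ?thesis .
qed

lemma recurrent_state_iff_avoid_prob:
  "recurrent_state K x \<longleftrightarrow> (\<lambda>k. avoid_prob K x k x) \<longlonglongrightarrow> 0"
proof -
  have "measure_pmf.prob (walk K k x) {xs. x \<in> set xs} = 1 - avoid_prob K x k x" for k
    unfolding avoid_prob_def
    by (subst measure_pmf.prob_compl[symmetric]) (auto intro!: arg_cong[where f = "measure_pmf.prob _"])
  then have "recurrent_state K x \<longleftrightarrow> (\<lambda>k. 1 - avoid_prob K x k x) \<longlonglongrightarrow> 1 - 0"
    by (simp add: recurrent_state_def)
  also have "\<dots> \<longleftrightarrow> (\<lambda>k. avoid_prob K x k x) \<longlonglongrightarrow> 0"
    using tendsto_diff[OF tendsto_const[of "1::real"], of "\<lambda>k. 1 - avoid_prob K x k x" "1 - 0" sequentially]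
      tendsto_diff[OF tendsto_const[of "1::real"], of "\<lambda>k. avoid_prob K x k x" 0 sequentially]
    by auto
  finally show ?thesis .
qed

lemma integrable_bounded_pmf:
  fixes f :: "'a \<Rightarrow> real"
  assumes "\<And>z. 0 \<le> f z" "\<And>z. f z \<le> 1"
  shows "integrable (measure_pmf M) f"
  by (rule measure_pmf.integrable_const_bound[where B = 1]) (use assms in auto)

lemma integrable_avoid_step:
  "integrable (measure_pmf M) (\<lambda>z. if z = x then 0 else avoid_prob K x k z)"
  by (rule integrable_bounded_pmf) (auto simp: avoid_prob_nonneg avoid_prob_le_1)

text \<open>Only the contribution of \<open>z\<close> to the one-step expectation is kept. This
  carries lower bounds on avoidance one step backwards.\<close>

lemma avoid_prob_Suc_ge:
  assumes "z \<noteq> x"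
  shows "pmf (K y) z * avoid_prob K x k z \<le> avoid_prob K x (Suc k) y"
proof -
  let ?f = "\<lambda>z. if z = x then 0 else avoid_prob K x k z"
  have "pmf (K y) z * avoid_prob K x k z = measure_pmf.expectation (K y) (\<lambda>w. indicator {z} w * ?f z)"
    using assms by (simp add: measure_pmf_single)
  also have "\<dots> \<le> measure_pmf.expectation (K y) ?f"
    by (intro integral_mono integrable_avoid_step integrable_bounded_pmf)
      (auto simp: indicator_def avoid_prob_nonneg avoid_prob_le_1)
  finally show ?thesis by (simp add: avoid_prob_Suc)
qed

text \<open>The integrand of the one-step expectation never exceeds 1 and is below 1 at
  \<open>z\<close>, which has positive mass.\<close>

lemma avoid_prob_Suc_less_1:
  assumes "z \<in> set_pmf (K y)" "z = x \<or> avoid_prob K x k z < 1"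
  shows "avoid_prob K x (Suc k) y < 1"
proof -
  let ?f = "\<lambda>z. if z = x then 0 else avoid_prob K x k z"
  have fz: "?f z < 1" using assms(2) by auto
  have f1: "?f w \<le> 1" for w by (simp add: avoid_prob_le_1)
  have "0 < pmf (K y) z * (1 - ?f z)"
    using fz pmf_positive[OF assms(1)] by simp
  also have "\<dots> = measure_pmf.expectation (K y) (\<lambda>w. indicator {z} w * (1 - ?f z))"
    by (simp add: measure_pmf_single)
  also have "\<dots> \<le> measure_pmf.expectation (K y) (\<lambda>w. 1 - ?f w)"
    by (intro integral_mono integrable_bounded_pmf)
      (auto simp: indicator_def avoid_prob_nonneg avoid_prob_le_1)
  also have "\<dots> = 1 - measure_pmf.expectation (K y) ?f"
    by (subst Bochner_Integration.integral_diff) (auto intro: integrable_avoid_step)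
  finally show ?thesis by (simp add: avoid_prob_Suc)
qed

lemma avoid_prob_closed:
  assumes "\<And>y z. y \<in> S \<Longrightarrow> z \<in> set_pmf (K y) \<Longrightarrow> z \<in> S" "x \<notin> S" "y \<in> S"
  shows "avoid_prob K x k y = 1"
  using assms(3)
proof (induction k arbitrary: y)
  case (Suc k)
  have "avoid_prob K x (Suc k) y = measure_pmf.expectation (K y) (\<lambda>z. 1)"
    unfolding avoid_prob_Suc
    by (rule integral_cong_AE) (use Suc assms(1,2) in \<open>auto simp: AE_measure_pmf_iff\<close>)
  then show ?case by simp
qed simp

text \<open>The Markov property at time \<open>a\<close>: the walk is then still in the closed set
  \<open>S\<close>, and from each state of \<open>S\<close> it avoids \<open>x\<close> for
  \<open>k\<close> more steps with probability at most \<open>B\<close>.\<close>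

lemma avoid_prob_mult:
  assumes closed: "\<And>y z. y \<in> S \<Longrightarrow> z \<in> set_pmf (K y) \<Longrightarrow> z \<in> S"
    and B: "\<And>z. z \<in> S \<Longrightarrow> avoid_prob K x k z \<le> B" and "y \<in> S"
  shows "avoid_prob K x (a + k) y \<le> B * avoid_prob K x a y"
  using assms(3)
proof (induction a arbitrary: y)
  case (Suc a)
  have "avoid_prob K x (Suc a + k) y
      \<le> measure_pmf.expectation (K y) (\<lambda>z. B * (if z = x then 0 else avoid_prob K x a z))"
    unfolding add_Suc avoid_prob_Suc
    by (rule integral_mono_AE)
      (use Suc closed in \<open>auto simp: AE_measure_pmf_iff intro: integrable_avoid_step\<close>)
  then show ?case by (simp add: avoid_prob_Suc)
qed (use B in simp)

lemma avoid_prob_antimono: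
  assumes "k \<le> l"
  shows "avoid_prob K x l y \<le> avoid_prob K x k y"
proof -
  have "avoid_prob K x (k + (l - k)) y \<le> 1 * avoid_prob K x k y"
    by (rule avoid_prob_mult[where S = UNIV]) (auto simp: avoid_prob_le_1)
  then show ?thesis using assms by simp
qed

text \<open>Finiteness of \<open>S\<close> gives a common time \<open>N\<close> and one bound
  \<open>B < 1\<close> on the probability of avoiding \<open>x\<close> for \<open>N\<close> steps.
  Over \<open>j\<close> such blocks avoidance has probability at most \<open>B ^ j\<close>, which
  tends to 0.\<close>

lemma recurrent_if_reachable_finite:
  assumes "finite S" and "x \<in> S"
    and closed: "\<And>y z. y \<in> S \<Longrightarrow> z \<in> set_pmf (K y) \<Longrightarrow> z \<in> S"
    and reach: "\<And>y. y \<in> S \<Longrightarrow> \<exists>k. avoid_prob K x k y < 1"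
  shows "recurrent_state K x"
proof -
  obtain t where t: "\<And>y. y \<in> S \<Longrightarrow> avoid_prob K x (t y) y < 1"
    using reach by metis
  define N where "N = Max (t ` S)"
  define B where "B = Max ((\<lambda>y. avoid_prob K x N y) ` S)"
  have lt: "avoid_prob K x N y < 1" if "y \<in> S" for y
  proof -
    have "t y \<le> N" using that \<open>finite S\<close> by (simp add: N_def)
    then have "avoid_prob K x N y \<le> avoid_prob K x (t y) y" by (rule avoid_prob_antimono)
    then show ?thesis using t[OF that] by simp
  qed
  have B1: "B < 1" unfolding B_def using assms(1,2) lt by (subst Max_less_iff) auto
  have B: "avoid_prob K x N y \<le> B" if "y \<in> S" for y
    using that \<open>finite S\<close> by (simp add: B_def)
  have B0: "0 \<le> B" by (rule order_trans[OF avoid_prob_nonneg B[OF \<open>x \<in> S\<close>]])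
  have pow: "avoid_prob K x (j * N) x \<le> B ^ j" for j
  proof (induction j)
    case (Suc j)
    have "avoid_prob K x (j * N + N) x \<le> B * avoid_prob K x (j * N) x"
      by (rule avoid_prob_mult[where S = S]) (use closed B \<open>x \<in> S\<close> in auto)
    also have "\<dots> \<le> B * B ^ j" using Suc B0 by (rule mult_left_mono)
    finally show ?case by (simp add: add.commute)
  qed simp
  have "(\<lambda>k. avoid_prob K x k x) \<longlonglongrightarrow> 0"
  proof (rule LIMSEQ_I)
    fix e :: real assume "0 < e"
    then obtain j where j: "B ^ j < e" using real_arch_pow_inv[OF _ B1] by blast
    have "norm (avoid_prob K x k x - 0) < e" if "k \<ge> j * N" for k
      using avoid_prob_antimono[OF that, of K x x] pow[of j] j avoid_prob_nonneg[of K x k x] by simp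
    then show "\<exists>no. \<forall>k\<ge>no. norm (avoid_prob K x k x - 0) < e" by blast
  qed
  then show ?thesis by (simp add: recurrent_state_iff_avoid_prob)
qed

section \<open>Recurrent configurations\<close>

lemma stable_add_grain:
  assumes "c \<in> stable_configs n" "i \<in> {1..n}" "c i < n - 1"
  shows "c(i := c i + 1) \<in> stable_configs n"
  using assms by (auto simp: stable_configs_def intro: configs_upd)

lemma Rec_parking:
  assumes \<mu>: "set_pmf \<mu> = {1..n}" and "c \<in> Rec n \<mu>"
  shows "parking n c"
proof (rule ccontr)
  assume np: "\<not> parking n c"
  define K where "K = sandpile_kernel n \<mu>"
  have stab: "c \<in> stable_configs n" and rec: "recurrent_state K c"
    using assms(2) by (auto simp: Rec_def K_def)
  \<comment> \<open>The bound has to be uniform in \<open>k\<close>. Only configurations above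
    \<open>c\<close> are considered: adding a grain to one of them gives an entry strictly larger
    than in \<open>c\<close>, so the climb towards a parking configuration cannot hit
    \<open>c\<close>.\<close>
  have "\<exists>\<delta>>0. \<forall>k. \<delta> \<le> avoid_prob K c k y"
    if "y \<in> stable_configs n" "\<forall>i\<in>{1..n}. c i \<le> y i" for y
    using that
  proof (induction y rule: measure_induct_rule[where f = "\<lambda>y. \<Sum>i\<in>{1..n}. n - y i"])
    case (less y)
    show ?case
    proof (cases "parking n y")
      case True
      have "avoid_prob K c k y = 1" for k
      proof (rule avoid_prob_closed[where S = "{z \<in> stable_configs n. parking n z}"])
        fix u v assume u: "u \<in> {z \<in> stable_configs n. parking n z}" and v: "v \<in> set_pmf (K u)"
        then have "v \<in> stable_configs n"
          using sandpile_kernel_stable[OF \<mu>, of u v] by (simp add: K_def)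
        moreover have "parking n v"
          using u v sandpile_kernel_parking[OF \<mu>, of u v] by (simp add: K_def)
        ultimately show "v \<in> {z \<in> stable_configs n. parking n z}" by simp
      qed (use True less.prems np in auto)
      then show ?thesis by (intro exI[of _ 1]) simp
    next
      case False
      \<comment> \<open>If all entries were at least \<open>n - 1\<close>, every vertex would be
        counted for every \<open>k\<close> from 1 on, and \<open>y\<close> would be parking.\<close>
      have "\<exists>i\<in>{1..n}. y i < n - 1"
      proof (rule ccontr)
        assume "\<not> ?thesis"
        then have "\<And>k. k \<in> {1..n} \<Longrightarrow> {i \<in> {1..n}. n \<le> y i + k} = {1..n}" by force
        then have "parking n y" by (simp add: parking_def)
        then show False using False by simp
      qed
      then obtain i where i: "i \<in> {1..n}" "y i < n - 1" by blast
      define z where "z = y(i := y i + 1)"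
      have zs: "z \<in> stable_configs n"
        unfolding z_def using less.prems(1) i by (rule stable_add_grain)
      have "(\<Sum>i\<in>{1..n}. n - z i) < (\<Sum>i\<in>{1..n}. n - y i)"
        by (rule sum_strict_mono_ex1) (use i in \<open>auto simp: z_def\<close>)
      moreover have "\<forall>i\<in>{1..n}. c i \<le> z i" using less.prems(2) by (auto simp: z_def le_SucI)
      ultimately have "\<exists>\<delta>>0. \<forall>k. \<delta> \<le> avoid_prob K c k z"
        using less.IH[of z] zs by simp
      then obtain \<delta> where \<delta>: "\<delta> > 0" "\<And>k. \<delta> \<le> avoid_prob K c k z" by metis
      have "z = stabilise n (y(i := y i + 1))"
        using stabilise_stable[OF zs] by (simp add: z_def)
      then have "z \<in> set_pmf (K y)"
        unfolding K_def set_sandpile_kernel[OF \<mu>] using i(1) by (rule image_eqI)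
      then have pos: "0 < pmf (K y) z" by (rule pmf_positive)
      have "z i > c i" using less.prems(2) i(1) by (auto simp: z_def le_imp_less_Suc)
      then have "z \<noteq> c" by auto
      \<comment> \<open>The minimum with 1 takes care of \<open>k = 0\<close>, where no step is made
        and the avoidance probability is 1.\<close>
      have "min 1 (pmf (K y) z * \<delta>) \<le> avoid_prob K c k y" for k
      proof (cases k)
        case (Suc l)
        have "pmf (K y) z * \<delta> \<le> pmf (K y) z * avoid_prob K c l z"
          using \<delta> by (intro mult_left_mono) auto
        also have "\<dots> \<le> avoid_prob K c k y"
          unfolding Suc using \<open>z \<noteq> c\<close> by (rule avoid_prob_Suc_ge)
        finally show ?thesis by simp
      qed simp
      moreover have "0 < min 1 (pmf (K y) z * \<delta>)" using pos \<delta>(1) by simp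
      ultimately show ?thesis by blast
    qed
  qed
  then obtain \<delta> where "\<delta> > 0" "\<And>k. \<delta> \<le> avoid_prob K c k c" using stab by blast
  moreover have "(\<lambda>k. avoid_prob K c k c) \<longlonglongrightarrow> 0"
    using rec by (simp add: recurrent_state_iff_avoid_prob)
  ultimately have "\<delta> \<le> 0" by (intro LIMSEQ_le_const) auto
  then show False using \<open>\<delta> > 0\<close> by simp
qed

section \<open>Adding grains, and recurrence of permutations\<close>

definition add_config :: "nat \<Rightarrow> config \<Rightarrow> config \<Rightarrow> config" where
  "add_config n c b = (\<lambda>i\<in>{1..n}. c i + b i)"

text \<open>Extra grains never make an unstable vertex stable, and adding them commutes with a legal
  toppling.\<close>

lemma topples_to_add_config:
  assumes "(topples_to n)\<^sup>*\<^sup>* c d"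
  shows "(topples_to n)\<^sup>*\<^sup>* (add_config n c b) (add_config n d b)"
  using assms
proof induction
  case (step d e)
  obtain i where i: "i \<in> {1..n}" "n \<le> d i" "e = topple n i d"
    using step.hyps(2) by (auto simp: topples_to_def)
  have "add_config n e b = topple n i (add_config n d b)"
    using i by (auto simp: add_config_def topple_def fun_eq_iff)
  then have "topples_to n (add_config n d b) (add_config n e b)"
    using i by (auto simp: topples_to_def add_config_def intro!: bexI[of _ i])
  then show ?case using step.IH by (simp add: rtranclp.rtrancl_into_rtrancl)
qed simp

text \<open>The abelian property: dropping the grains of \<open>b\<close> one at a time and
  stabilising after each leads to the same \<open>x\<close> as adding them all at once. Each drop is
  a possible step of the chain. At least one grain is required because visits count only from time 1
  on.\<close>

lemma avoid_prob_less_1_if_topples_to: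
  assumes \<mu>: "set_pmf \<mu> = {1..n}" and x: "x \<in> stable_configs n"
    and "y \<in> stable_configs n" "0 < sum b {1..n}"
    and "(topples_to n)\<^sup>*\<^sup>* (add_config n y b) x"
  shows "\<exists>k. avoid_prob (sandpile_kernel n \<mu>) x k y < 1"
  using assms(3-)
proof (induction "sum b {1..n}" arbitrary: b y)
  case (Suc m)
  obtain i where i: "i \<in> {1..n}" "0 < b i"
    using Suc.prems(2) by (metis gr0I sum.neutral not_less_zero)
  define b' where "b' = b(i := b i - 1)"
  define y' where "y' = y(i := y i + 1)"
  define z where "z = stabilise n y'"
  have y': "y' \<in> configs n"
    unfolding y'_def using stable_configsD[OF Suc.prems(1)] i(1) by (rule configs_upd)
  note z = stabilise_props[OF y', folded z_def]
  have zK: "z \<in> set_pmf (sandpile_kernel n \<mu> y)"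
    unfolding set_sandpile_kernel[OF \<mu>] z_def y'_def using i(1) by blast
  have "sum b {1..n} = b i + sum b ({1..n} - {i})" "sum b' {1..n} = b' i + sum b' ({1..n} - {i})"
    using i(1) by (auto intro!: sum.remove)
  moreover have "sum b' ({1..n} - {i}) = sum b ({1..n} - {i})"
    by (intro sum.cong) (auto simp: b'_def)
  ultimately have sum: "m = sum b' {1..n}" using Suc.hyps(2) i(2) by (simp add: b'_def)
  have "add_config n y b = add_config n y' b'"
    using i(2) by (auto simp: add_config_def y'_def b'_def fun_eq_iff)
  then have "(topples_to n)\<^sup>*\<^sup>* (add_config n y b) (add_config n z b')"
    using topples_to_add_config[OF z(1)] by simp
  \<comment> \<open>By confluence both results have a common successor, and since \<open>x\<close>
    is stable that successor is \<open>x\<close>.\<close>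
  then obtain u where u: "(topples_to n)\<^sup>*\<^sup>* x u" "(topples_to n)\<^sup>*\<^sup>* (add_config n z b') u"
    using confluentpD[OF confluentp_topples_to Suc.prems(3)] by blast
  then have to_x: "(topples_to n)\<^sup>*\<^sup>* (add_config n z b') x"
    using stable_topples_to_rtranclp[OF u(1) x] by simp
  show ?case
  proof (cases "m = 0")
    case True
    then have "\<And>j. j \<in> {1..n} \<Longrightarrow> b' j = 0" using sum by auto
    then have "add_config n z b' = z"
      using z(2) by (auto simp: add_config_def stable_configs_def configs_def fun_eq_iff PiE_def extensional_def)
    then have "z = x" using stable_topples_to_rtranclp[OF _ z(2)] to_x by metis
    then show ?thesis using avoid_prob_Suc_less_1[of z "sandpile_kernel n \<mu>" y x 0] zK by blast
  next
    case False
    then have "0 < m" by simp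
    then obtain k where "avoid_prob (sandpile_kernel n \<mu>) x k z < 1"
      using Suc.hyps(1)[OF sum z(2) _ to_x] sum by metis
    then show ?thesis using avoid_prob_Suc_less_1[of z "sandpile_kernel n \<mu>" y x k] zK by blast
  qed
qed simp

lemma inj_stable_bij:
  assumes "c \<in> stable_configs n" "inj_on c {1..n}"
  shows "bij_betw c {1..n} {..<n}"
proof -
  have "c ` {1..n} \<subseteq> {..<n}" using assms(1) by (auto simp: stable_configs_def)
  moreover have "card (c ` {1..n}) = card {..<n}" using assms(2) by (simp add: card_image)
  ultimately show ?thesis using assms(2) by (simp add: bij_betw_def card_subset_eq)
qed

text \<open>A form of Dhar's burning test: the vertices topple in decreasing order of their entries,
  each exactly once. A vertex receives \<open>n - 1\<close> grains from the others and the one added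
  at the start, and loses \<open>n\<close>.\<close>

lemma add_all_topples_to:
  assumes x: "x \<in> stable_configs n" and inj: "inj_on x {1..n}"
  shows "(topples_to n)\<^sup>*\<^sup>* (add_config n x (\<lambda>_. 1)) x"
proof -
  \<comment> \<open>The configuration after the vertices with entries \<open>n - 1\<close> down to
    \<open>n - k\<close> have toppled. The next one, with entry \<open>n - Suc k\<close>, then holds
    exactly \<open>n\<close> grains.\<close>
  define f where "f k = (\<lambda>i\<in>{1..n}. if n \<le> x i + k then x i + k - n else x i + 1 + k)" for k
  have "(topples_to n)\<^sup>*\<^sup>* (f 0) (f k)" if "k \<le> n" for k
    using that
  proof (induction k)
    case (Suc k)
    have "n - Suc k \<in> {..<n}" using Suc.prems by auto
    then obtain i where i: "i \<in> {1..n}" "x i = n - Suc k"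
      using inj_stable_bij[OF x inj] by (metis bij_betw_def imageE)
    have other: "x j \<noteq> n - Suc k" if "j \<in> {1..n}" "j \<noteq> i" for j
      using that i inj by (metis inj_onD)
    have "f (Suc k) j = topple n i (f k) j" for j
      using i Suc.prems other[of j] by (auto simp: f_def topple_def)
    then have "f (Suc k) = topple n i (f k)" by blast
    moreover have "n \<le> f k i" using i Suc.prems by (auto simp: f_def)
    ultimately have "topples_to n (f k) (f (Suc k))" using i(1) by (auto simp: topples_to_def)
    then show ?case using Suc by (meson Suc_leD rtranclp.rtrancl_into_rtrancl)
  qed simp
  moreover have "f 0 = add_config n x (\<lambda>_. 1)"
    using x by (force simp: f_def add_config_def stable_configs_def fun_eq_iff)
  moreover have "f n = x"
    using x by (auto simp: f_def stable_configs_def configs_def fun_eq_iff PiE_def extensional_def)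
  ultimately show ?thesis by (metis order_refl)
qed

lemma add_multiple_topples_to:
  assumes x: "x \<in> stable_configs n" and inj: "inj_on x {1..n}"
  shows "(topples_to n)\<^sup>*\<^sup>* (add_config n x (\<lambda>_. m)) x"
proof (induction m)
  case 0
  have "add_config n x (\<lambda>_. 0) = x"
    using x by (auto simp: add_config_def stable_configs_def configs_def fun_eq_iff PiE_def extensional_def)
  then show ?case by simp
next
  case (Suc m)
  have "add_config n (add_config n x (\<lambda>_. 1)) (\<lambda>_. m) = add_config n x (\<lambda>_. Suc m)"
    by (auto simp: add_config_def fun_eq_iff)
  then have "(topples_to n)\<^sup>*\<^sup>* (add_config n x (\<lambda>_. Suc m)) (add_config n x (\<lambda>_. m))"
    using topples_to_add_config[OF add_all_topples_to[OF assms], of "\<lambda>_. m"] by simp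
  then show ?case using Suc by (rule rtranclp_trans)
qed

lemma inj_stable_Rec:
  assumes \<mu>: "set_pmf \<mu> = {1..n}" and "n \<ge> 1"
    and x: "x \<in> stable_configs n" and inj: "inj_on x {1..n}"
  shows "x \<in> Rec n \<mu>"
proof -
  have "\<exists>k. avoid_prob (sandpile_kernel n \<mu>) x k y < 1" if y: "y \<in> stable_configs n" for y
  proof -
    have lt: "\<And>i. i \<in> {1..n} \<Longrightarrow> y i < n" using y by (simp add: stable_configs_def)
    \<comment> \<open>Chosen so that \<open>y\<close> plus \<open>b\<close> is \<open>x\<close> with
      \<open>n\<close> grains added everywhere. As \<open>y i < n\<close>, the subtraction does not
      truncate and \<open>b i\<close> is positive.\<close>
    define b where "b i = x i + n - y i" for i
    have "0 < b 1" using lt[of 1] \<open>n \<ge> 1\<close> by (simp add: b_def)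
    then have "0 < sum b {1..n}" using \<open>n \<ge> 1\<close> by (intro sum_pos2[of _ 1]) auto
    moreover have "add_config n y b = add_config n x (\<lambda>_. n)"
      using lt by (auto simp: add_config_def b_def fun_eq_iff less_imp_le trans_le_add2)
    ultimately show ?thesis
      using avoid_prob_less_1_if_topples_to[OF \<mu> x y] add_multiple_topples_to[OF x inj] by metis
  qed
  then have "recurrent_state (sandpile_kernel n \<mu>) x"
    using finite_stable_configs x sandpile_kernel_stable[OF \<mu>]
    by (intro recurrent_if_reachable_finite[where S = "stable_configs n"])
  then show ?thesis using x by (simp add: Rec_def)
qed

section \<open>Minimality of permutations\<close>

lemma image_below:
  fixes f :: "'a \<Rightarrow> nat"
  assumes "{..<v} \<subseteq> f ` A"
  shows "f ` {i \<in> A. f i < v} = {..<v}"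
proof
  show "{..<v} \<subseteq> f ` {i \<in> A. f i < v}"
  proof
    fix u assume "u \<in> {..<v}"
    moreover from this obtain i where "i \<in> A" "f i = u" using assms by blast
    ultimately show "u \<in> f ` {i \<in> A. f i < v}" by auto
  qed
qed auto

text \<open>Let \<open>d\<close> be recurrent and below \<open>x\<close>, and let
  \<open>v = d i + 1 < n\<close>. Exactly \<open>v\<close> vertices have entry below
  \<open>v\<close> in \<open>x\<close>; they also do in \<open>d\<close>, where at most
  \<open>v\<close> are allowed. The two sets agree, and \<open>i\<close> lies in the second, hence
  in the first.\<close>

lemma inj_stable_MinRec:
  assumes \<mu>: "set_pmf \<mu> = {1..n}" and "n \<ge> 1"
    and x: "x \<in> stable_configs n" and inj: "inj_on x {1..n}"
  shows "x \<in> MinRec n \<mu>"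
proof -
  have "d = x" if d: "d \<in> Rec n \<mu>" and le: "\<forall>i\<in>{1..n}. d i \<le> x i" for d
  proof -
    have dc: "d \<in> stable_configs n" using d by (simp add: Rec_def)
    have "x i \<le> d i" if i: "i \<in> {1..n}" for i
    proof (cases "Suc (d i) < n")
      case True
      let ?v = "Suc (d i)"
      have "x ` {j \<in> {1..n}. x j < ?v} = {..<?v}"
        by (rule image_below) (use inj_stable_bij[OF x inj] True in \<open>auto simp: bij_betw_def\<close>)
      moreover have "inj_on x {j \<in> {1..n}. x j < ?v}" using inj by (rule inj_on_subset) auto
      ultimately have "card {j \<in> {1..n}. x j < ?v} = ?v" by (metis card_image card_lessThan)
      moreover have "card {j \<in> {1..n}. d j < ?v} \<le> ?v"
        using Rec_parking[OF \<mu> d] True by (rule parking_card_below)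
      moreover have "{j \<in> {1..n}. x j < ?v} \<subseteq> {j \<in> {1..n}. d j < ?v}"
        using le by (auto intro: order.strict_trans1)
      ultimately have "{j \<in> {1..n}. x j < ?v} = {j \<in> {1..n}. d j < ?v}"
        by (intro card_seteq) auto
      then have "i \<in> {j \<in> {1..n}. x j < ?v}" using i by simp
      then show ?thesis by simp
    next
      case False
      moreover have "x i < n" using x i by (simp add: stable_configs_def)
      ultimately show ?thesis by simp
    qed
    then have "\<forall>i\<in>{1..n}. d i = x i" using le by (simp add: le_antisym)
    then show ?thesis using dc x
      by (auto simp: stable_configs_def configs_def intro: PiE_ext)
  qed
  then show ?thesis using inj_stable_Rec[OF assms] by (auto simp: MinRec_def)
qed

section \<open>Reduction and the MVP process\<close>

text \<open>The loop runs through the values from \<open>c i\<close> down to \<open>w\<close>, each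
  but the last being held by another index. Only the entry at \<open>i\<close> changes, so the
  hypotheses survive each decrement.\<close>

lemma lower_entry_eq:
  assumes "w \<le> c i" "\<And>v. w < v \<Longrightarrow> v \<le> c i \<Longrightarrow> \<exists>j'\<in>{1..j} - {i}. c j' = v"
    and "\<not> (\<exists>j'\<in>{1..j} - {i}. c j' = w)"
  shows "lower_entry i j c = Some (c(i := w))"
  using assms
proof (induction "c i - w" arbitrary: c)
  case 0
  then have "c i = w" by simp
  then show ?case using 0 by (subst lower_entry.simps) (auto simp: fun_upd_idem)
next
  case (Suc m)
  let ?d = "c(i := c i - 1)"
  have "\<exists>j'\<in>{1..j} - {i}. c j' = c i" using Suc.prems(2)[of "c i"] Suc.hyps(2) by auto
  then have "lower_entry i j c = lower_entry i j ?d" by (subst lower_entry.simps) simp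
  also have "\<dots> = Some (?d(i := w))"
  proof (rule Suc.hyps(1))
    show "\<exists>j'\<in>{1..j} - {i}. ?d j' = v" if "w < v" "v \<le> ?d i" for v
      using Suc.prems(2)[of v] that by fastforce
  qed (use Suc in auto)
  finally show ?case by simp
qed

text \<open>
  If all values up to \<open>c (Suc j)\<close> were taken, let \<open>v\<close> be the least value not taken. An index whose
  entry is now below \<open>v\<close> started below \<open>v\<close>, for otherwise \<open>v\<close> would be taken. Together with
  \<open>Suc j\<close> these are more than \<open>v\<close> indices starting below \<open>v\<close>.
\<close>

lemma parking_free_value:
  assumes park: "parking n c" and stab: "c \<in> stable_configs n"
    and j: "Suc j \<le> n"
    and le: "\<And>i. i \<in> {1..j} \<Longrightarrow> m i \<le> c i"
    and filled: "\<And>i v. i \<in> {1..j} \<Longrightarrow> m i \<le> v \<Longrightarrow> v \<le> c i \<Longrightarrow> v \<in> m ` {1..j}"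
    and occ: "c (Suc j) \<in> m ` {1..j}"
  shows "\<exists>v<c (Suc j). v \<notin> m ` {1..j}"
proof (rule ccontr)
  assume "\<not> ?thesis"
  then have all: "v \<in> m ` {1..j}" if "v \<le> c (Suc j)" for v
    using that occ by (metis le_neq_implies_less)
  have lt: "m i < n" if "i \<in> {1..j}" for i
    using le[OF that] that stab j by (auto simp: stable_configs_def intro: order.strict_trans1)
  then have ex: "n \<notin> m ` {1..j}" by blast
  define v where "v = (LEAST v. v \<notin> m ` {1..j})"
  have v: "v \<notin> m ` {1..j}" unfolding v_def using ex by (rule LeastI)
  have "v \<le> n" unfolding v_def using ex by (rule Least_le)
  have below: "u \<in> m ` {1..j}" if "u < v" for u using that not_less_Least v_def by blast
  have cv: "c (Suc j) < v" using all v by (meson not_le)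
  let ?A = "{i \<in> {1..j}. m i < v}"
  have "m ` ?A = {..<v}" using below by (intro image_below) blast
  then have "v \<le> card ?A" using card_image_le[of ?A m] by auto
  then have "Suc v \<le> card (insert (Suc j) ?A)" by (subst card_insert_disjoint) auto
  also have "\<dots> \<le> card {i \<in> {1..n}. c i < v}"
  proof (rule card_mono)
    have "c i < v" if "i \<in> ?A" for i
      using filled[of i v] v that by (metis (no_types, lifting) leI less_imp_le mem_Collect_eq)
    then show "insert (Suc j) ?A \<subseteq> {i \<in> {1..n}. c i < v}" using cv j by auto
  qed simp
  finally have *: "Suc v \<le> card {i \<in> {1..n}. c i < v}" .
  show False
  \<comment> \<open>\<open>parking_card_below\<close> needs \<open>v < n\<close>; for
    \<open>v = n\<close> the count would exceed the number of vertices.\<close>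
  proof (cases "v < n")
    case True
    then show False using parking_card_below[OF park True] * by simp
  next
    case False
    then have "v = n" using \<open>v \<le> n\<close> by simp
    moreover have "card {i \<in> {1..n}. c i < v} \<le> card {1..n}" by (rule card_mono) auto
    ultimately show False using * by simp
  qed
qed

text \<open>One pass of the outer loop: injectivity on the first \<open>j\<close> indices makes
  \<open>Suc j\<close> the first repeat and \<open>i\<close> its unique partner, and
  \<open>w\<close> is the largest missing value below their common entry.\<close>

lemma reduction_lower_first_repeat:
  assumes inj: "inj_on m {1..j}" and "Suc j \<le> n" and i: "i \<in> {1..j}" "m i = m (Suc j)"
    and w: "w < m i" "w \<notin> m ` {1..j}" "\<And>v. w < v \<Longrightarrow> v < m i \<Longrightarrow> v \<in> m ` {1..j}"
  shows "reduction n m = reduction n (m(i := w))"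
proof -
  have "first_repeat m = Suc j"
    unfolding first_repeat_def
  proof (rule Least_equality)
    have "m (Suc j) \<in> m ` {1..<Suc j}" using i by (metis atLeastLessThanSuc_atLeastAtMost imageI)
    then show "1 \<le> Suc j \<and> m (Suc j) \<in> m ` {1..<Suc j}" by simp
  next
    fix l assume l: "1 \<le> l \<and> m l \<in> m ` {1..<l}"
    show "Suc j \<le> l"
    proof (rule ccontr)
      assume "\<not> Suc j \<le> l"
      moreover obtain i' where "i' \<in> {1..<l}" "m i' = m l" using l by auto
      ultimately show False using inj l by (auto dest: inj_onD)
    qed
  qed
  moreover have "(THE i. i \<in> {1..<Suc j} \<and> m i = m (Suc j)) = i"
  proof (rule the_equality)
    show "i \<in> {1..<Suc j} \<and> m i = m (Suc j)" using i by auto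
    show "l = i" if "l \<in> {1..<Suc j} \<and> m l = m (Suc j)" for l
      by (rule inj_onD[OF inj]) (use that i in auto)
  qed
  moreover have "\<not> inj_on m {1..n}"
  proof
    assume "inj_on m {1..n}"
    then have "i = Suc j" by (rule inj_onD) (use i assms(2) in auto)
    then show False using i by simp
  qed
  moreover have "lower_entry i (Suc j) m = Some (m(i := w))"
  proof (rule lower_entry_eq)
    show "\<exists>j'\<in>{1..Suc j} - {i}. m j' = v" if "w < v" "v \<le> m i" for v
    proof (cases "v = m i")
      case True
      then show ?thesis using i by (intro bexI[of _ "Suc j"]) auto
    next
      case False
      then have "v \<in> m ` {1..j}" using w(3) that by simp
      then obtain l where "l \<in> {1..j}" "m l = v" by auto
      then show ?thesis using False by (intro bexI[of _ l]) auto
    qed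
    show "\<not> (\<exists>j'\<in>{1..Suc j} - {i}. m j' = w)"
    proof
      assume "\<exists>j'\<in>{1..Suc j} - {i}. m j' = w"
      then obtain l where "l \<in> {1..Suc j}" "m l = w" by blast
      then have "l = Suc j" using w(2) by (cases "l = Suc j") auto
      then show False using \<open>m l = w\<close> w(1) i(2) by simp
    qed
  qed (use w in simp)
  ultimately show ?thesis by (subst reduction.simps) (simp add: Let_def)
qed

text \<open>The clause on \<open>{m i..c i}\<close> records that lowering only passes over taken
  values and that taken values stay taken. Through \<open>parking_free_value\<close> it guarantees
  that the loop stops at a natural number and that a bumped car finds a spot. The last clause puts
  car \<open>i\<close> in spot \<open>n - m i\<close>, written additively to avoid truncated
  subtraction.\<close>

lemma reduction_mvp_invariant:
  assumes park: "parking n c" and stab: "c \<in> stable_configs n" and "j \<le> n"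
  shows "\<exists>m\<in>configs n. (\<forall>i\<in>{1..j}. m i \<le> c i) \<and> (\<forall>i. i \<notin> {1..j} \<longrightarrow> m i = c i)
    \<and> inj_on m {1..j} \<and> (\<forall>i\<in>{1..j}. {m i..c i} \<subseteq> m ` {1..j})
    \<and> reduction n c = reduction n m
    \<and> (\<forall>k i. foldl (mvp_step n (parking_preference n c)) Map.empty [1..<j+1] k = Some i
          \<longleftrightarrow> i \<in> {1..j} \<and> m i + k = n)"
  using \<open>j \<le> n\<close>
proof (induction j)
  case 0
  show ?case using stab by (intro bexI[of _ c]) (auto simp: stable_configs_def)
next
  case (Suc j)
  let ?p = "parking_preference n c"
  let ?J = "Suc j"
  define s where "s = foldl (mvp_step n ?p) Map.empty [1..<j+1]"
  have fold: "foldl (mvp_step n ?p) Map.empty [1..<?J+1] = mvp_step n ?p s ?J"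
    by (simp add: s_def)
  obtain m where conf: "m \<in> configs n" and le: "\<And>i. i \<in> {1..j} \<Longrightarrow> m i \<le> c i"
    and out: "\<And>i. i \<notin> {1..j} \<Longrightarrow> m i = c i" and inj: "inj_on m {1..j}"
    and filled: "\<And>i. i \<in> {1..j} \<Longrightarrow> {m i..c i} \<subseteq> m ` {1..j}"
    and red: "reduction n c = reduction n m"
    and s: "\<And>k i. s k = Some i \<longleftrightarrow> i \<in> {1..j} \<and> m i + k = n"
    using Suc.IH Suc.prems unfolding s_def by auto
  have J: "?J \<in> {1..n}" using Suc.prems by simp
  have cn: "\<And>i. i \<in> {1..n} \<Longrightarrow> c i < n" using stab by (simp add: stable_configs_def)
  have mJ: "m ?J = c ?J" by (rule out) simp
  have p: "?p ?J = n - c ?J" using J by (simp add: parking_preference_def)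
  have None: "s k = None \<longleftrightarrow> n - k \<notin> m ` {1..j}" if "k \<le> n" for k
  proof -
    have "s k = None \<longleftrightarrow> \<not> (\<exists>i. i \<in> {1..j} \<and> m i + k = n)" using s by (metis not_None_eq)
    also have "\<dots> \<longleftrightarrow> \<not> (\<exists>i\<in>{1..j}. n - k = m i)"
      using that by (metis add_diff_cancel_right' le_add_diff_inverse2)
    finally show ?thesis by (simp add: image_iff)
  qed
  show ?case
  proof (cases "c ?J \<in> m ` {1..j}")
    \<comment> \<open>The preferred spot is free: car \<open>?J\<close> parks there, no repeat
      arises and \<open>m\<close> is kept.\<close>
    case False
    have "s (?p ?J) = None" using None[of "n - c ?J"] False cn[OF J] p by simp
    then have step: "mvp_step n ?p s ?J = s(n - c ?J \<mapsto> ?J)" by (simp add: mvp_step_def p)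
    have ins: "{1..?J} = insert ?J {1..j}" by auto
    show ?thesis
    proof (intro bexI[of _ m] conjI)
      show "\<forall>i\<in>{1..?J}. m i \<le> c i" using le mJ ins by auto
      show "\<forall>i. i \<notin> {1..?J} \<longrightarrow> m i = c i" using out by auto
      show "inj_on m {1..?J}" unfolding ins using inj False mJ by auto
      show "\<forall>i\<in>{1..?J}. {m i..c i} \<subseteq> m ` {1..?J}" unfolding ins using filled mJ by fastforce
      show "\<forall>k i. foldl (mvp_step n ?p) Map.empty [1..<?J+1] k = Some i
          \<longleftrightarrow> i \<in> {1..?J} \<and> m i + k = n"
      proof (intro allI)
        fix k i
        have "i \<in> {1..j} \<Longrightarrow> m i \<noteq> c ?J" using False by (metis image_eqI)
        then show "foldl (mvp_step n ?p) Map.empty [1..<?J+1] k = Some i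
          \<longleftrightarrow> i \<in> {1..?J} \<and> m i + k = n"
          unfolding fold step ins using cn[OF J] mJ s[of k i] by auto
      qed
    qed (use red conf in auto)
  next
    case True
    then obtain i where i: "i \<in> {1..j}" "m i = c ?J" by auto
    \<comment> \<open>The maximum of \<open>W\<close> is the value at which the lowering of entry
      \<open>i\<close> stops.\<close>
    define W where "W = {v. v < c ?J \<and> v \<notin> m ` {1..j}}"
    have "W \<noteq> {}"
    proof -
      have "\<exists>v<c ?J. v \<notin> m ` {1..j}"
        by (rule parking_free_value[OF park stab Suc.prems]) (use le filled True in \<open>auto simp: subset_iff\<close>)
      then show ?thesis by (auto simp: W_def)
    qed
    moreover have "finite W" by (simp add: W_def)
    ultimately have "Max W \<in> W" and W_max: "\<And>v. v \<in> W \<Longrightarrow> v \<le> Max W" by auto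
    define w where "w = Max W"
    have w: "w < c ?J" "w \<notin> m ` {1..j}" using \<open>Max W \<in> W\<close> by (auto simp: W_def w_def)
    have w_max: "v \<in> m ` {1..j}" if "w < v" "v < c ?J" for v
    proof (rule ccontr)
      assume "v \<notin> m ` {1..j}"
      then have "v \<in> W" using that by (simp add: W_def)
      then show False using W_max that by (fastforce simp: w_def)
    qed
    define m' where "m' = m(i := w)"
    have ins: "{1..?J} = insert i (insert ?J ({1..j} - {i}))" using i by auto
    have m'_simps: "m' i = w" "m' ?J = c ?J" "\<And>l. l \<in> {1..j} - {i} \<Longrightarrow> m' l = m l"
      using i mJ by (auto simp: m'_def)
    \<comment> \<open>No value is freed: \<open>i\<close> moves to \<open>w\<close>, and its old
      value is still held by \<open>?J\<close>.\<close>
    have img: "insert w (m ` {1..j}) \<subseteq> m' ` {1..?J}"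
    proof
      fix v assume "v \<in> insert w (m ` {1..j})"
      then consider "v = w" | l where "l \<in> {1..j} - {i}" "v = m l" | "v = m i" by blast
      then show "v \<in> m' ` {1..?J}"
      proof cases
        case 1 then show ?thesis unfolding ins using m'_simps(1) by simp
      next
        case 2 then show ?thesis unfolding ins using m'_simps(3) by (metis image_eqI insertI2)
      next
        case 3 then show ?thesis unfolding ins using m'_simps(2) i(2) by auto
      qed
    qed
    have s_i: "s (?p ?J) = Some i" using s i p cn[OF J] by simp
    have s_w: "s (n - w) = None" using None[of "n - w"] w cn[OF J] by simp
    have pw: "n - c ?J < n - w" using w(1) cn[OF J] by linarith
    \<comment> \<open>The map from \<open>v\<close> to \<open>n - v\<close> reverses order, so the
      largest missing value below \<open>c ?J\<close> is the first free spot after the preferred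
      one.\<close>
    have "(LEAST k. n - c ?J < k \<and> s k = None) = n - w"
    proof (rule Least_equality)
      fix k assume k: "n - c ?J < k \<and> s k = None"
      show "n - w \<le> k"
      proof (rule ccontr)
        assume "\<not> n - w \<le> k"
        then have "w < n - k" "n - k < c ?J" "k \<le> n" using k by auto
        then show False using w_max None k by blast
      qed
    qed (use s_w pw in simp)
    moreover have "\<exists>k\<in>{?p ?J<..n}. s k = None"
      using s_w pw p by (intro bexI[of _ "n - w"]) auto
    ultimately have step: "mvp_step n ?p s ?J = s(n - c ?J \<mapsto> ?J, n - w \<mapsto> i)"
      using s_i by (simp add: mvp_step_def p)
    show ?thesis
    proof (intro bexI[of _ m'] conjI)
      show "\<forall>l\<in>{1..?J}. m' l \<le> c l"
        using le i w mJ unfolding ins m'_def by fastforce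
      show "\<forall>l. l \<notin> {1..?J} \<longrightarrow> m' l = c l" using out i by (auto simp: m'_def)
      have "inj_on m' ({1..j} - {i})"
        using inj m'_simps(3) by (metis (no_types, lifting) Diff_subset inj_on_cong inj_on_subset)
      moreover have "c ?J \<notin> m' ` ({1..j} - {i})"
      proof
        assume "c ?J \<in> m' ` ({1..j} - {i})"
        then obtain l where l: "l \<in> {1..j} - {i}" "m l = m i" using m'_simps(3) i(2) by fastforce
        then have "l = i" using i(1) by (intro inj_onD[OF inj, of l i]) auto
        then show False using l by simp
      qed
      moreover have "w \<notin> m' ` ({1..j} - {i})" using m'_simps(3) w(2) by auto
      ultimately show "inj_on m' {1..?J}"
        unfolding ins using m'_simps(1,2) w(1) i(1) by (auto simp: inj_on_insert)
      show "\<forall>l\<in>{1..?J}. {m' l..c l} \<subseteq> m' ` {1..?J}"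
      proof (intro ballI subsetI)
        fix l v assume l: "l \<in> {1..?J}" and v: "v \<in> {m' l..c l}"
        from l consider "l = i" | "l = ?J" | "l \<in> {1..j} - {i}" unfolding ins by blast
        then have "v \<in> insert w (m ` {1..j})"
        proof cases
          case 1
          \<comment> \<open>The new interval of \<open>i\<close> splits at \<open>c ?J\<close>, its
            old entry: below it the values other than \<open>w\<close> are taken by maximality of
            \<open>w\<close>, and from it on by the old invariant.\<close>
          then have v': "w \<le> v" "v \<le> c i" using v m'_simps by auto
          show ?thesis
          proof (cases "v < c ?J")
            case True
            then show ?thesis using v' w_max by (cases "v = w") auto
          next
            case False
            then have "v \<in> {m i..c i}" using v' i by auto
            then show ?thesis using filled i(1) by blast
          qed
        next
          case 2
          then have "v = m i" using v m'_simps i by auto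
          then show ?thesis using i(1) by blast
        next
          case 3
          then have "v \<in> {m l..c l}" using v m'_simps(3) by simp
          then show ?thesis using filled 3 by blast
        qed
        then show "v \<in> m' ` {1..?J}" using img by blast
      qed
      show "reduction n c = reduction n m'"
        unfolding red m'_def
        by (rule reduction_lower_first_repeat[OF inj Suc.prems i(1)]) (use i mJ w w_max in auto)
      show "\<forall>k l. foldl (mvp_step n ?p) Map.empty [1..<?J+1] k = Some l
          \<longleftrightarrow> l \<in> {1..?J} \<and> m' l + k = n"
      proof (intro allI)
        fix k l
        have "k = n - w \<longleftrightarrow> w + k = n" "k = n - c ?J \<longleftrightarrow> c ?J + k = n" using w cn[OF J] by auto
        moreover have "l \<in> {1..j} \<Longrightarrow> m l \<noteq> w" using w(2) by blast
        moreover have "l \<in> {1..j} \<Longrightarrow> l \<noteq> i \<Longrightarrow> m l \<noteq> c ?J" using i inj by (metis inj_onD)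
        ultimately show "foldl (mvp_step n ?p) Map.empty [1..<?J+1] k = Some l
          \<longleftrightarrow> l \<in> {1..?J} \<and> m' l + k = n"
          unfolding fold step using s[of k l] i mJ w(1) by (auto simp: m'_def le_Suc_eq)
      qed
      show "m' \<in> configs n" unfolding m'_def using conf i Suc.prems by (intro configs_upd) auto
    qed
  qed
qed

theorem theorem5p9:
  fixes n :: nat and \<mu> :: "nat pmf" and c :: config
  assumes "n \<ge> 1"
    and "set_pmf \<mu> = {1..n}"
    and "c \<in> Rec n \<mu>"
  shows "\<exists>minrec. reduction n c = Some minrec \<and> minrec \<in> MinRec n \<mu> \<and>
    mvp_outcome n (parking_preference n c) = Some (CanTop n minrec)"
proof -
  have stab: "c \<in> stable_configs n" using assms(3) by (simp add: Rec_def)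
  define s where "s = foldl (mvp_step n (parking_preference n c)) Map.empty [1..<n+1]"
  obtain m where conf: "m \<in> configs n" and le: "\<And>i. i \<in> {1..n} \<Longrightarrow> m i \<le> c i"
    and inj: "inj_on m {1..n}" and red: "reduction n c = reduction n m"
    and s: "\<And>k i. s k = Some i \<longleftrightarrow> i \<in> {1..n} \<and> m i + k = n"
    using reduction_mvp_invariant[OF Rec_parking[OF assms(2,3)] stab order_refl]
    unfolding s_def by auto
  have m: "m \<in> stable_configs n"
    using conf le stab unfolding stable_configs_def by (blast intro: order.strict_trans1)
  \<comment> \<open>The final \<open>m\<close> is a permutation of the values below
    \<open>n\<close>, so spot \<open>k\<close> holds the unique car with entry \<open>n - k\<close>,
    which is the index chosen by \<open>CanTop\<close>. In particular no spot stays empty.\<close>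
  have ex: "\<exists>i. s k = Some i \<and> (THE j. j \<in> {1..n} \<and> m j = n - k) = i" if k: "k \<in> {1..n}" for k
  proof -
    have "n - k \<in> m ` {1..n}" using inj_stable_bij[OF m inj] k by (auto simp: bij_betw_def)
    then obtain i where i: "i \<in> {1..n}" "m i = n - k" by auto
    then have "(THE j. j \<in> {1..n} \<and> m j = n - k) = i"
      by (intro the_equality) (auto intro: inj_onD[OF inj])
    then show ?thesis using s i k by auto
  qed
  then have "{1..n} \<subseteq> dom s" by blast
  moreover have "restrict_id (\<lambda>k. the (s k)) {1..n} = CanTop n m"
    unfolding CanTop_def restrict_id_def using ex by (auto simp: fun_eq_iff)
  ultimately have "mvp_outcome n (parking_preference n c) = Some (CanTop n m)"
    unfolding mvp_outcome_def Let_def s_def[symmetric] by simp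
  moreover have "reduction n c = Some m" unfolding red using inj by (subst reduction.simps) simp
  ultimately show ?thesis using inj_stable_MinRec[OF assms(2,1) m inj] by blast
qed

end
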